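(* Let $S\subseteq\mathbb{R}^D$ be any convex set that is positively invariant with respect to a dynamical system with globally defined trajectories $\mathbf{y}(t)\in S$ (for all $t>0$) starting from initial conditions $\mathbf{y}_0\in S$. Let $\mathbf{r}_j$, $j=0,\ldots,N-1$, be $N$ points taken on any one of these trajectories. Then all points of the curve $$\mathbf{r}_{\kappa}(t)=\sum_{j=0}^{N-1}\mathbf{r}_{j}\,\frac{\mathcal{B}_{\kappa}\left(t-j,\frac{1}{2}\right)}{\mathcal{B}_{\kappa}\left(t-\frac{N-1}{2},\frac{N}{2}\right)}$$ satisfy $\mathbf{r}_{\kappa}(t)\in S$ for all $\kappa>0$ and all real $t\in[0,N-1]$.
   Context: For $\kappa>0$ and $x,y\in\mathbb{R}$, $$\mathcal{B}_{\kappa}(x,y):=\frac{1}{2}\left[\tanh\left(\frac{x+y}{\kappa}\right)-\tanh\left(\frac{x-y}{\kappa}\right)\right].$$ Here $N\ge 1$ and $D\ge 1$ are integers and the state space of the dynamical system is $\mathbb{R}^D$. A set $S$ is positively invariant with respect to a dynamical system if any trajectory $\mathbf{y}(t)$ of the dynamical system that is well defined for any $t>0$ and that starts with initial condition $\mathbf{y}_0\in S$ satisfies $\mathbf{y}(t)\in S$ for $t>0$. The parameter $t$ of the curve $\mathbf{r}_\kappa(t)$ is the curve's own real parameter; the points $\mathbf{r}_j$ form a finite ordered sequence, possibly with repetitions. *)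

theory Defs
  imports "HOL-Analysis.Analysis"
begin

definition B_kappa :: "real \<Rightarrow> real \<Rightarrow> real \<Rightarrow> real" where
  "B_kappa \<kappa> x y = 1/2 * (tanh ((x + y) / \<kappa>) - tanh ((x - y) / \<kappa>))"

definition B_kappa_curve :: "real \<Rightarrow> nat \<Rightarrow> (nat \<Rightarrow> 'a::real_vector) \<Rightarrow> real \<Rightarrow> 'a" where
  "B_kappa_curve \<kappa> N r t =
     (\<Sum>j<N. (B_kappa \<kappa> (t - real j) (1/2)
              / B_kappa \<kappa> (t - (real N - 1) / 2) (real N / 2)) *\<^sub>R r j)"

(* A dynamical system is a partial semiflow: \<Phi> t x is the state at time t of the trajectory
   started at x, and None if that trajectory does not exist up to time t (e.g. blow-up in
   finite time). The time set T is {0..} in continuous time and \<nat> in discrete time.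
   No continuity or differentiability is imposed, and no value outside T is constrained. *)
definition dynamical_system :: "real set \<Rightarrow> (real \<Rightarrow> 'a \<Rightarrow> 'a option) \<Rightarrow> bool" where
  "dynamical_system T \<Phi> \<longleftrightarrow>
     T \<subseteq> {0..} \<and> 0 \<in> T \<and> (\<forall>s\<in>T. \<forall>t\<in>T. s + t \<in> T) \<and>
     (\<forall>x. \<Phi> 0 x = Some x) \<and>
     (\<forall>s\<in>T. \<forall>t\<in>T. \<forall>x. \<Phi> (s + t) x = Option.bind (\<Phi> s x) (\<Phi> t))"

definition global_trajectory :: "real set \<Rightarrow> (real \<Rightarrow> 'a \<Rightarrow> 'a option) \<Rightarrow> (real \<Rightarrow> 'a) \<Rightarrow> bool" where
  "global_trajectory T \<Phi> y \<longleftrightarrow> (\<forall>t\<in>T. \<Phi> t (y 0) = Some (y t))"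

definition positively_invariant :: "real set \<Rightarrow> (real \<Rightarrow> 'a \<Rightarrow> 'a option) \<Rightarrow> 'a set \<Rightarrow> bool" where
  "positively_invariant T \<Phi> S \<longleftrightarrow>
     (\<forall>y. global_trajectory T \<Phi> y \<and> y 0 \<in> S \<longrightarrow> (\<forall>t\<in>T. t > 0 \<longrightarrow> y t \<in> S))"

end

(* The numerators B_kappa (t - j) (1/2) are positive, and their sum telescopes to the denominator,
   so every point of the curve is a convex combination of the points r_j, which lie in S by
   positive invariance. *)
theory Submission
  imports Defs
begin

text \<open>\<open>tanh\<close> is strictly increasing, and for positive \<open>y\<close> and
  \<open>\<kappa>\<close> its argument is larger in the first term of \<open>B_kappa\<close> than in
  the second.\<close>

lemma B_kappa_pos:
  assumes "\<kappa> > 0" "y > 0"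
  shows "B_kappa \<kappa> x y > 0"
proof -
  have "(x - y) / \<kappa> < (x + y) / \<kappa>"
    using assms by (intro divide_strict_right_mono) auto
  then show ?thesis
    by (simp add: B_kappa_def)
qed

lemma sum_B_kappa_half:
  "(\<Sum>j<N. B_kappa \<kappa> (t - real j) (1/2)) = B_kappa \<kappa> (t - (real N - 1) / 2) (real N / 2)"
proof -
  \<comment> \<open>The summand with index \<open>j\<close> subtracts \<open>tanh\<close> at
    \<open>t - j - 1/2\<close>, scaled by \<open>\<kappa>\<close>; this is
    \<open>t - (j + 1) + 1/2\<close>, so the subtracted term is \<open>f (Suc j)\<close>.\<close>
  define f where "f j = tanh ((t - real j + 1/2) / \<kappa>)" for j
  have "B_kappa \<kappa> (t - real j) (1/2) = 1/2 * (f j - f (Suc j))" for j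
    by (simp add: B_kappa_def f_def algebra_simps)
  then have "(\<Sum>j<N. B_kappa \<kappa> (t - real j) (1/2)) = 1/2 * (f 0 - f N)"
    by (simp only: sum_lessThan_telescope' flip: sum_distrib_left)
  also have "\<dots> = B_kappa \<kappa> (t - (real N - 1) / 2) (real N / 2)"
  proof -
    \<comment> \<open>Centre and half-width of the denominator yield exactly the arguments of the
      two surviving terms \<open>f 0\<close> and \<open>f N\<close>; \<open>real 0\<close> is kept
      to match the unfolded \<open>f 0\<close> literally.\<close>
    have "t - (real N - 1) / 2 + real N / 2 = t - real 0 + 1/2"
      "t - (real N - 1) / 2 - real N / 2 = t - real N + 1/2"
      by (simp_all add: field_simps)
    then show ?thesis
      unfolding B_kappa_def f_def by (simp only:)
  qed
  finally show ?thesis .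
qed

lemma B_kappa_curve_in_convex:
  assumes "convex S" "\<kappa> > 0" "N \<ge> 1" "\<And>j. j < N \<Longrightarrow> r j \<in> S"
  shows "B_kappa_curve \<kappa> N r t \<in> S"
proof -
  let ?d = "B_kappa \<kappa> (t - (real N - 1) / 2) (real N / 2)"
  \<comment> \<open>\<open>N \<ge> 1\<close> makes the half-width \<open>real N / 2\<close>
    positive, so the normalising division is a genuine one.\<close>
  have d: "?d > 0"
    using assms by (intro B_kappa_pos) auto
  show ?thesis
    unfolding B_kappa_curve_def
  proof (rule convex_sum)
    show "(\<Sum>j<N. B_kappa \<kappa> (t - real j) (1/2) / ?d) = 1"
      using d unfolding sum_divide_distrib[symmetric] sum_B_kappa_half by simp
    show "0 \<le> B_kappa \<kappa> (t - real j) (1/2) / ?d" for j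
      using d B_kappa_pos[OF \<open>\<kappa> > 0\<close>, of "1/2" "t - real j"] by simp
  qed (use assms in auto)
qed

text \<open>Positive invariance speaks only of times \<open>t > 0\<close>; time 0 is covered by the
  initial condition, and \<open>T\<close> contains no negative times.\<close>

lemma positively_invariant_trajectory_in:
  assumes "T \<subseteq> {0..}" "positively_invariant T \<Phi> S" "global_trajectory T \<Phi> y"
    "y 0 \<in> S" "t \<in> T"
  shows "y t \<in> S"
  using assms by (cases "t = 0") (auto simp: positively_invariant_def)

theorem mainTheorem2:
  fixes T :: "real set"
    and \<Phi> :: "real \<Rightarrow> real ^ 'd \<Rightarrow> (real ^ 'd) option"
    and S :: "(real ^ 'd) set"
    and y :: "real \<Rightarrow> real ^ 'd"
    and N :: nat
    and r :: "nat \<Rightarrow> real ^ 'd"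
  assumes "dynamical_system T \<Phi>"
    and "convex S"
    and "positively_invariant T \<Phi> S"
    and "global_trajectory T \<Phi> y"
    and "y 0 \<in> S"
    and "N \<ge> 1"
    and "\<And>j. j < N \<Longrightarrow> r j \<in> y ` T"
  shows "\<forall>\<kappa>>0. \<forall>t\<in>{0..real N - 1}. B_kappa_curve \<kappa> N r t \<in> S"
proof -
  have "T \<subseteq> {0..}"
    using assms(1) unfolding dynamical_system_def by (rule conjunct1)
  then have "y t \<in> S" if "t \<in> T" for t
    using assms(3-5) that by (rule positively_invariant_trajectory_in)
  then have "y ` T \<subseteq> S"
    by (rule image_subsetI)
  then have "r j \<in> S" if "j < N" for j
    using assms(7)[OF that] by (rule subsetD)
  then show ?thesis
    using assms(2,6) by (auto intro: B_kappa_curve_in_convex)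
qed

end
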